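(* Let $\alpha_\nu,\beta_\nu>0$ for $\nu=1,\dots,N$. Suppose that $\mathbf{x}^*=(x^{1,*},\dots,x^{N,*})$ and, for every $\nu=1,\dots,N$, vectors $z^{\nu,*}\in\mathbb{R}^{m_\nu}$, $\lambda^{\nu,*}\in\mathbb{R}^{m_\nu}_+$, $\mu^{\nu,*}\in\mathbb{R}^{m_\nu}$ are such that, for every $\nu$, $(x^{\nu,*},x^{-\nu,*},z^{\nu,*},\lambda^{\nu,*},\mu^{\nu,*})$ is a saddle point of the Proximal-Perturbed Lagrangian $\mathcal{L}^\nu_{\alpha\beta}$ for the given $x^{-\nu}=x^{-\nu,*}$, i.e. $x^{\nu,*}\in\mathcal{X}_\nu$ and $$\mathcal{L}_{\alpha\beta}^{\nu}(x^{\nu,*},x^{-\nu,*},z^{\nu,*},\lambda^{\nu},\mu^{\nu})\le \mathcal{L}_{\alpha\beta}^{\nu}(x^{\nu,*},x^{-\nu,*},z^{\nu,*},\lambda^{\nu,*},\mu^{\nu,*})\le \mathcal{L}_{\alpha\beta}^{\nu}(x^{\nu},x^{-\nu,*},z^{\nu},\lambda^{\nu,*},\mu^{\nu,*})$$ for all $(x^\nu,z^\nu,\lambda^\nu,\mu^\nu)\in\mathcal{X}_\nu\times\mathbb{R}^{m_\nu}\times\mathbb{R}^{m_\nu}_+\times\mathbb{R}^{m_\nu}$. Then $\mathbf{x}^*$ is a generalized Nash equilibrium of the GNEP.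
   Context: Generalized Nash equilibrium problem (GNEP): there are $N$ players; player $\nu$ chooses $x^\nu\in\mathbb{R}^{n_\nu}$; $\mathbf{x}=(x^1,\dots,x^N)=(x^\nu,x^{-\nu})\in\mathbb{R}^n$, $n=\sum_\nu n_\nu$, where $x^{-\nu}$ collects the other players' strategies. Given $x^{-\nu}$, player $\nu$ minimizes $\theta_\nu(x^\nu,x^{-\nu})$ over $x^\nu$ in $\mathcal{F}_\nu(x^{-\nu})=\{x^\nu\in\mathcal{X}_\nu : g^\nu_i(x^\nu,x^{-\nu})\le 0,\ i=1,\dots,m_\nu\}$, where $\mathcal{X}_\nu=\{x^\nu\in\mathbb{R}^{n_\nu}: l_\nu\le x^\nu\le u_\nu\}$ is a nonempty box with possibly infinite bounds. Write $g^\nu=(g^\nu_1,\dots,g^\nu_{m_\nu})$. Point $\mathbf{x}^*$ is a generalized Nash equilibrium (GNE) if for every $\nu$, $x^{\nu,*}\in\mathcal{F}_\nu(x^{-\nu,*})$ and $\theta_\nu(x^{\nu,*},x^{-\nu,*})\le\theta_\nu(x^\nu,x^{-\nu,*})$ for all $x^\nu\in\mathcal{F}_\nu(x^{-\nu,*})$. Standing assumption: for every $\nu$ and fixed $x^{-\nu}$, $\theta_\nu(\cdot,x^{-\nu})$ and $g^\nu_i(\cdot,x^{-\nu})$ ($i=1,\dots,m_\nu$) are continuously differentiable and convex in $x^\nu$. Proximal-Perturbed Lagrangian: for $\alpha_\nu,\beta_\nu>0$, $$\mathcal{L}_{\alpha\beta}^{\nu}(x^{\nu},x^{-\nu},z^{\nu},\lambda^{\nu},\mu^{\nu})=\theta_\nu(x^\nu,x^{-\nu})+(\lambda^\nu)^T(g^\nu(x^\nu,x^{-\nu})-z^\nu)+(\mu^\nu)^Tz^\nu+\tfrac{\alpha_\nu}{2}\|z^\nu\|^2-\tfrac{\beta_\nu}{2}\|\lambda^\nu-\mu^\nu\|^2,$$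 with $z^\nu\in\mathbb{R}^{m_\nu}$, $\lambda^\nu\in\mathbb{R}^{m_\nu}_+$, $\mu^\nu\in\mathbb{R}^{m_\nu}$. *)

theory Defs
  imports "HOL-Analysis.Analysis"
begin

text \<open>
  The players are the elements of the finite type \<open>'p\<close>. As the dimensions $n_\nu$ differ between
  players, a profile is a single vector \<open>x :: real ^ 'n\<close> (so $n$ is \<open>CARD('n)\<close>), and
  \<open>own :: 'n \<Rightarrow> 'p\<close> tells which player controls which coordinate: $x^\nu$ is the
  subvector of the coordinates \<open>j\<close> with \<open>own j = \<nu>\<close>, and
  $n_\nu$ is \<open>card {j. own j = \<nu>}\<close>.

  A strategy of player \<open>\<nu>\<close> alone is represented by any \<open>y :: real ^ 'n\<close>, of which only
  the coordinates owned by \<open>\<nu>\<close> are ever read.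

  Player \<open>\<nu>\<close> has \<open>m \<nu>\<close> constraints, possibly none. A vector of $R^{m_\nu}$ is a function
  \<open>nat \<Rightarrow> real\<close> of which only the entries in \<open>{1..m \<nu>}\<close> are ever read.
\<close>

text \<open>The profile $(y^\nu, x^{-\nu})$.\<close>

definition deviate :: "('n::finite \<Rightarrow> 'p) \<Rightarrow> 'p \<Rightarrow> real ^ 'n \<Rightarrow> real ^ 'n \<Rightarrow> real ^ 'n" where
  "deviate own \<nu> y x = (\<chi> j. if own j = \<nu> then y $ j else x $ j)"

definition strategy_box ::
  "('n::finite \<Rightarrow> 'p) \<Rightarrow> ('n \<Rightarrow> ereal) \<Rightarrow> ('n \<Rightarrow> ereal) \<Rightarrow> 'p \<Rightarrow> (real ^ 'n) set" where
  "strategy_box own l u \<nu> =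
     {y. \<forall>j. own j = \<nu> \<longrightarrow> l j \<le> ereal (y $ j) \<and> ereal (y $ j) \<le> u j}"

definition feasible_strategies ::
  "('n::finite \<Rightarrow> 'p) \<Rightarrow> ('n \<Rightarrow> ereal) \<Rightarrow> ('n \<Rightarrow> ereal) \<Rightarrow> ('p \<Rightarrow> nat) \<Rightarrow>
   ('p \<Rightarrow> nat \<Rightarrow> real ^ 'n \<Rightarrow> real) \<Rightarrow> 'p \<Rightarrow> real ^ 'n \<Rightarrow> (real ^ 'n) set" where
  "feasible_strategies own l u m g \<nu> x =
     {y \<in> strategy_box own l u \<nu>. \<forall>i\<in>{1..m \<nu>}. g \<nu> i (deviate own \<nu> y x) \<le> 0}"

definition generalized_Nash_equilibrium ::
  "('n::finite \<Rightarrow> 'p) \<Rightarrow> ('n \<Rightarrow> ereal) \<Rightarrow> ('n \<Rightarrow> ereal) \<Rightarrow> ('p \<Rightarrow> real ^ 'n \<Rightarrow> real) \<Rightarrow>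
   ('p \<Rightarrow> nat) \<Rightarrow> ('p \<Rightarrow> nat \<Rightarrow> real ^ 'n \<Rightarrow> real) \<Rightarrow> real ^ 'n \<Rightarrow> bool" where
  "generalized_Nash_equilibrium own l u \<theta> m g x \<longleftrightarrow>
     (\<forall>\<nu>. x \<in> feasible_strategies own l u m g \<nu> x \<and>
          (\<forall>y \<in> feasible_strategies own l u m g \<nu> x. \<theta> \<nu> x \<le> \<theta> \<nu> (deviate own \<nu> y x)))"

definition continuously_differentiable :: "(real ^ 'n::finite \<Rightarrow> real) \<Rightarrow> bool" where
  "continuously_differentiable f \<longleftrightarrow>
     (\<exists>f' :: real ^ 'n \<Rightarrow> ((real ^ 'n) \<Rightarrow>\<^sub>L real).
        (\<forall>y. (f has_derivative blinfun_apply (f' y)) (at y)) \<and> continuous_on UNIV f')"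

text \<open>
  The function \<open>\<lambda>y. f (deviate own \<nu> y x)\<close> on \<open>real ^ 'n\<close> is $f(\cdot, x^{-\nu})$ composed with the
  coordinate projection onto the block of \<open>\<nu>\<close>, so it is convex (continuously differentiable)
  exactly if $f(\cdot, x^{-\nu})$ is so on $R^{n_\nu}$.
\<close>

definition smooth_convex_in_own_block ::
  "('n::finite \<Rightarrow> 'p) \<Rightarrow> 'p \<Rightarrow> (real ^ 'n \<Rightarrow> real) \<Rightarrow> bool" where
  "smooth_convex_in_own_block own \<nu> f \<longleftrightarrow>
     (\<forall>x. continuously_differentiable (\<lambda>y. f (deviate own \<nu> y x)) \<and>
          convex_on UNIV (\<lambda>y. f (deviate own \<nu> y x)))"

text \<open>The argument \<open>x\<close> is the whole profile $(x^\nu, x^{-\nu})$.\<close>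

definition prox_perturbed_Lagrangian ::
  "('p \<Rightarrow> real ^ 'n::finite \<Rightarrow> real) \<Rightarrow> ('p \<Rightarrow> nat) \<Rightarrow> ('p \<Rightarrow> nat \<Rightarrow> real ^ 'n \<Rightarrow> real) \<Rightarrow>
   ('p \<Rightarrow> real) \<Rightarrow> ('p \<Rightarrow> real) \<Rightarrow> 'p \<Rightarrow>
   real ^ 'n \<Rightarrow> (nat \<Rightarrow> real) \<Rightarrow> (nat \<Rightarrow> real) \<Rightarrow> (nat \<Rightarrow> real) \<Rightarrow> real" where
  "prox_perturbed_Lagrangian \<theta> m g \<alpha> \<beta> \<nu> x z lam mu =
     \<theta> \<nu> x
     + (\<Sum>i\<in>{1..m \<nu>}. lam i * (g \<nu> i x - z i))
     + (\<Sum>i\<in>{1..m \<nu>}. mu i * z i)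
     + \<alpha> \<nu> / 2 * (\<Sum>i\<in>{1..m \<nu>}. (z i)\<^sup>2)
     - \<beta> \<nu> / 2 * (\<Sum>i\<in>{1..m \<nu>}. (lam i - mu i)\<^sup>2)"

definition nonneg_multipliers :: "nat \<Rightarrow> (nat \<Rightarrow> real) set" where
  "nonneg_multipliers k = {lam. \<forall>i\<in>{1..k}. 0 \<le> lam i}"

definition PPL_saddle_point ::
  "('n::finite \<Rightarrow> 'p) \<Rightarrow> ('n \<Rightarrow> ereal) \<Rightarrow> ('n \<Rightarrow> ereal) \<Rightarrow> ('p \<Rightarrow> real ^ 'n \<Rightarrow> real) \<Rightarrow>
   ('p \<Rightarrow> nat) \<Rightarrow> ('p \<Rightarrow> nat \<Rightarrow> real ^ 'n \<Rightarrow> real) \<Rightarrow> ('p \<Rightarrow> real) \<Rightarrow> ('p \<Rightarrow> real) \<Rightarrow> 'p \<Rightarrow>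
   real ^ 'n \<Rightarrow> (nat \<Rightarrow> real) \<Rightarrow> (nat \<Rightarrow> real) \<Rightarrow> (nat \<Rightarrow> real) \<Rightarrow> bool" where
  "PPL_saddle_point own l u \<theta> m g \<alpha> \<beta> \<nu> x z lam mu \<longleftrightarrow>
     x \<in> strategy_box own l u \<nu> \<and> lam \<in> nonneg_multipliers (m \<nu>) \<and>
     (\<forall>y \<in> strategy_box own l u \<nu>. \<forall>z'. \<forall>lam' \<in> nonneg_multipliers (m \<nu>). \<forall>mu'.
        prox_perturbed_Lagrangian \<theta> m g \<alpha> \<beta> \<nu> x z lam' mu'
          \<le> prox_perturbed_Lagrangian \<theta> m g \<alpha> \<beta> \<nu> x z lam mu \<and>
        prox_perturbed_Lagrangian \<theta> m g \<alpha> \<beta> \<nu> x z lam mu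
          \<le> prox_perturbed_Lagrangian \<theta> m g \<alpha> \<beta> \<nu> (deviate own \<nu> y x) z' lam mu)"

end

theory Submission
  imports Defs
begin

text \<open>
  The Lagrangian is the classical one, $\theta_\nu + (\lambda^\nu)^T g^\nu$, plus a term in $z^\nu$
  and $\mu^\nu - \lambda^\nu$ only. Moving $\lambda^\nu$ and $\mu^\nu$ together, or varying
  $x^\nu$ at fixed $z^\nu$, leaves that term unchanged, so the saddle point inequalities reduce to
  the classical ones, which force feasibility, complementarity and optimality.
\<close>

lemma prox_perturbed_Lagrangian_split:
  "prox_perturbed_Lagrangian \<theta> m g \<alpha> \<beta> \<nu> x z lam mu =
     \<theta> \<nu> x + (\<Sum>i\<in>{1..m \<nu>}. lam i * g \<nu> i x)
     + ((\<Sum>i\<in>{1..m \<nu>}. (mu i - lam i) * z i)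
        + \<alpha> \<nu> / 2 * (\<Sum>i\<in>{1..m \<nu>}. (z i)\<^sup>2)
        - \<beta> \<nu> / 2 * (\<Sum>i\<in>{1..m \<nu>}. (mu i - lam i)\<^sup>2))"
  by (simp add: prox_perturbed_Lagrangian_def right_diff_distrib left_diff_distrib
      sum_subtractf power2_commute)

lemma deviate_self [simp]: "deviate own \<nu> x x = x"
  by (simp add: deviate_def vec_eq_iff)

context
  fixes own :: "'n::finite \<Rightarrow> 'p"
    and l u \<theta> m g \<alpha> \<beta> \<nu> x z lam mu
  assumes saddle: "PPL_saddle_point own l u \<theta> m g \<alpha> \<beta> \<nu> x z lam mu"
begin

text \<open>The left saddle inequality makes \<open>lam\<close> a maximizer of the classical
  Lagrangian at the fixed profile \<open>x\<close>, once the terms in \<open>z\<close> and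
  \<open>mu - lam\<close> cancel.\<close>

lemma PPL_saddle_point_multiplier_le:
  assumes "lam' \<in> nonneg_multipliers (m \<nu>)"
  shows "(\<Sum>i\<in>{1..m \<nu>}. lam' i * g \<nu> i x) \<le> (\<Sum>i\<in>{1..m \<nu>}. lam i * g \<nu> i x)"
proof -
  \<comment> \<open>As \<open>mu\<close> carries no sign constraint, it may be shifted along with
    \<open>lam'\<close>, so that the difference of the two multipliers stays
    \<open>mu i - lam i\<close>.\<close>
  have "prox_perturbed_Lagrangian \<theta> m g \<alpha> \<beta> \<nu> x z lam' (\<lambda>i. lam' i + (mu i - lam i))
      \<le> prox_perturbed_Lagrangian \<theta> m g \<alpha> \<beta> \<nu> x z lam mu"
    using saddle assms unfolding PPL_saddle_point_def by blast
  then show ?thesis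
    by (simp add: prox_perturbed_Lagrangian_split)
qed

lemma PPL_saddle_point_strategy_le:
  assumes "y \<in> strategy_box own l u \<nu>"
  shows "\<theta> \<nu> x + (\<Sum>i\<in>{1..m \<nu>}. lam i * g \<nu> i x)
    \<le> \<theta> \<nu> (deviate own \<nu> y x) + (\<Sum>i\<in>{1..m \<nu>}. lam i * g \<nu> i (deviate own \<nu> y x))"
proof -
  \<comment> \<open>Keeping \<open>z' = z\<close> makes the terms outside the classical Lagrangian
    equal on both sides.\<close>
  have "prox_perturbed_Lagrangian \<theta> m g \<alpha> \<beta> \<nu> x z lam mu
      \<le> prox_perturbed_Lagrangian \<theta> m g \<alpha> \<beta> \<nu> (deviate own \<nu> y x) z lam mu"
    using saddle assms unfolding PPL_saddle_point_def by blast
  then show ?thesis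
    by (simp add: prox_perturbed_Lagrangian_split)
qed

lemma PPL_saddle_point_multiplier_nonneg:
  "i \<in> {1..m \<nu>} \<Longrightarrow> 0 \<le> lam i"
  using saddle by (simp add: PPL_saddle_point_def nonneg_multipliers_def)

text \<open>A violated constraint would let an increase of its multiplier raise the multiplier sum
  above its maximum.\<close>

lemma PPL_saddle_point_feasible: "x \<in> feasible_strategies own l u m g \<nu> x"
proof -
  have "g \<nu> i x \<le> 0" if i: "i \<in> {1..m \<nu>}" for i
  proof -
    \<comment> \<open>The test multiplier adds the \<open>i\<close>-th unit vector to
      \<open>lam\<close>; the sum then changes by exactly \<open>g \<nu> i x\<close>.\<close>
    have "(\<lambda>k. lam k + of_bool (k = i)) \<in> nonneg_multipliers (m \<nu>)"
      using PPL_saddle_point_multiplier_nonneg by (simp add: nonneg_multipliers_def)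
    from PPL_saddle_point_multiplier_le[OF this]
    have "(\<Sum>k\<in>{1..m \<nu>}. of_bool (k = i) * g \<nu> k x) \<le> 0"
      by (simp add: distrib_right sum.distrib)
    also have "(\<Sum>k\<in>{1..m \<nu>}. of_bool (k = i) * g \<nu> k x)
        = (\<Sum>k\<in>{1..m \<nu>}. if k = i then g \<nu> k x else 0)"
      by (rule sum.cong) auto
    also have "\<dots> = g \<nu> i x"
      using i by simp
    finally show ?thesis .
  qed
  with saddle show ?thesis
    by (simp add: feasible_strategies_def PPL_saddle_point_def)
qed

lemma PPL_saddle_point_optimal:
  assumes "y \<in> feasible_strategies own l u m g \<nu> x"
  shows "\<theta> \<nu> x \<le> \<theta> \<nu> (deviate own \<nu> y x)"
proof -
  \<comment> \<open>Comparison with the zero multiplier gives this half of complementarity.\<close>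
  have "0 \<le> (\<Sum>i\<in>{1..m \<nu>}. lam i * g \<nu> i x)"
    using PPL_saddle_point_multiplier_le[of "\<lambda>_. 0"] by (simp add: nonneg_multipliers_def)
  moreover have "(\<Sum>i\<in>{1..m \<nu>}. lam i * g \<nu> i (deviate own \<nu> y x)) \<le> 0"
    using assms PPL_saddle_point_multiplier_nonneg
    by (intro sum_nonpos mult_nonneg_nonpos) (auto simp: feasible_strategies_def)
  moreover have "y \<in> strategy_box own l u \<nu>"
    using assms by (simp add: feasible_strategies_def)
  ultimately show ?thesis
    using PPL_saddle_point_strategy_le[of y] by linarith
qed

end

theorem theorem1:
  fixes own :: "'n::finite \<Rightarrow> 'p::finite"
    and l u :: "'n \<Rightarrow> ereal"
    and \<theta> :: "'p \<Rightarrow> real ^ 'n \<Rightarrow> real"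
    and m :: "'p \<Rightarrow> nat"
    and g :: "'p \<Rightarrow> nat \<Rightarrow> real ^ 'n \<Rightarrow> real"
    and \<alpha> \<beta> :: "'p \<Rightarrow> real"
    and x :: "real ^ 'n"
    and z lam mu :: "'p \<Rightarrow> nat \<Rightarrow> real"
  assumes box_nonempty: "\<And>\<nu>. strategy_box own l u \<nu> \<noteq> {}"
    and cost: "\<And>\<nu>. smooth_convex_in_own_block own \<nu> (\<theta> \<nu>)"
    and constraints: "\<And>\<nu> i. i \<in> {1..m \<nu>} \<Longrightarrow> smooth_convex_in_own_block own \<nu> (g \<nu> i)"
    and alpha_pos: "\<And>\<nu>. \<alpha> \<nu> > 0"
    and beta_pos: "\<And>\<nu>. \<beta> \<nu> > 0"
    and saddle: "\<And>\<nu>. PPL_saddle_point own l u \<theta> m g \<alpha> \<beta> \<nu> x (z \<nu>) (lam \<nu>) (mu \<nu>)"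
  shows "generalized_Nash_equilibrium own l u \<theta> m g x"
  unfolding generalized_Nash_equilibrium_def
  using PPL_saddle_point_feasible[OF saddle] PPL_saddle_point_optimal[OF saddle] by blast

end
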